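(* Let $\alpha$ be a finite set, $\tau$ an involution on $\alpha$, $S\subseteq\alpha\times\alpha\times\alpha$, and $r$ a positive integer. Let $p$ and $q$ be two $r$-component nanophrases over $\alpha$. If there exists a finite type invariant $v$ of degree $1$ (for the homotopy given by $(\alpha,\tau,S)$) such that $v(p)\neq v(q)$, then $L(p)\neq L(q)$, i.e. $p$ and $q$ can be distinguished by the linking matrix.
   Context: Nanophrases and homotopy. An $r$-component Gauss phrase is a sequence of $r$ (possibly empty) finite words, written separated by the symbol $|$, such that every letter occurring in it occurs exactly twice in total. An $r$-component nanophrase over $\alpha$ is an $r$-component Gauss phrase $p$ together with a map $A\mapsto |A|$ from the set of letters appearing in $p$ to $\alpha$. Two nanophrases are isomorphic if a bijection of their letter sets preserving the map to $\alpha$ carries one Gauss phrase to the other letterwise. The homotopy given by $(\alpha,\tau,S)$ is the equivalence relation on $r$-component nanophrases generated by isomorphism and the moves (in both directions) H1: $xAAy\leftrightarrow xy$; H2: $xAByBAz\leftrightarrow xyz$ if $|A|=\tau(|B|)$; H3: $xAByACzBCt\leftrightarrow xBAyCAzCBt$ if $(|A|,|B|,|C|)\in S$; here $x,y,z,t$ are arbitrary sequences of letters, possibly including $|$, such that both sides are nanophrases, and all remaining letters keep their images in $\alpha$. An involution is a map $\tau$ with $\tau\circ\tau=\mathrm{id}$. Finite type invariants. $P(\alpha,\tau,S,r)$ is the set of homotopy classes of $r$-component nanophrases and $\mathbb{Z}P(\alpha,\tau,S,r)$ the free abelian group on it. A homotopy invariant is a function on $P(\alpha,\tau,S,r)$ with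 values in an additive abelian group, extended linearly to $\mathbb{Z}P(\alpha,\tau,S,r)$. A nanophrase in which a letter $A$ is marked as a semi-letter $\dot A$ denotes the formal sum $x\dot Ay\dot Az=xAyAz-xyz$; applied recursively, this defines nanophrases with any number of semi-letters as elements of $\mathbb{Z}P(\alpha,\tau,S,r)$. A homotopy invariant $v$ is a finite type invariant if there is an integer $n$ such that $v(p)=0$ for every nanophrase $p$ with more than $n$ semi-letters; the least such $n\ge 0$ is the degree of $v$. Linking matrix. $\pi$ is the abelian group (written additively) generated by the elements of $\alpha$ with relations $a+\tau(a)=0$ for all $a\in\alpha$. For an $r$-component nanophrase $p$ let $\mathcal{A}_{ij}(p)$ be the set of letters with one occurrence in the $i$th component and the other in the $j$th component. Put $l_{ii}(p)=0$ and $l_{ij}(p)=\sum_{X\in\mathcal{A}_{ij}(p)}|X|\in\pi$ for $i\neq j$. $L(p)$ is the symmetric $r\times r$ matrix $(l_{ij}(p))$. It is known to be a homotopy invariant for every homotopy data $(\alpha,\tau,S)$. *)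

theory Defs
  imports "HOL-Algebra.Free_Abelian_Groups" "Jordan_Normal_Form.Matrix"
begin

text \<open>
  Letters are drawn from the countably infinite alphabet \<^typ>\<open>nat\<close>; since homotopy includes
  isomorphism, this loses nothing. The value of \<open>proj\<close> outside the letters that occur is fixed
  to be \<^const>\<open>undefined\<close>, so \<open>proj\<close> is really a map on the letter set.
\<close>

datatype 'a nanophrase = Nanophrase (words: "nat list list") (proj: "nat \<Rightarrow> 'a")

definition letters :: "'a nanophrase \<Rightarrow> nat set" where
  "letters p = set (concat (words p))"

definition gauss_phrase :: "nat \<Rightarrow> nat list list \<Rightarrow> bool" where
  "gauss_phrase r ws \<longleftrightarrow>
     length ws = r \<and> (\<forall>A \<in> set (concat ws). count_list (concat ws) A = 2)"

definition nanophrases :: "'a set \<Rightarrow> nat \<Rightarrow> 'a nanophrase set" where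
  "nanophrases \<alpha> r = {p. gauss_phrase r (words p) \<and> proj p \<in> letters p \<rightarrow>\<^sub>E \<alpha>}"

definition isomorphic :: "'a nanophrase \<Rightarrow> 'a nanophrase \<Rightarrow> bool" where
  "isomorphic p q \<longleftrightarrow>
     (\<exists>f. bij_betw f (letters p) (letters q) \<and> words q = map (map f) (words p) \<and>
          (\<forall>A \<in> letters p. proj q (f A) = proj p A))"

text \<open>
  The moves act on a phrase written as one sequence with separators, because the unaffected
  parts \<open>x, y, z, t\<close> may contain separators.
\<close>

datatype symb = Letter nat | Bar

fun written :: "nat list list \<Rightarrow> symb list" where
  "written [] = []"
| "written [w] = map Letter w"
| "written (w # ws) = map Letter w @ [Bar] @ written ws"

inductive move :: "'a set \<Rightarrow> ('a \<Rightarrow> 'a) \<Rightarrow> ('a \<times> 'a \<times> 'a) set \<Rightarrow> nat \<Rightarrow>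
    'a nanophrase \<Rightarrow> 'a nanophrase \<Rightarrow> bool"
  for \<alpha> \<tau> S r where
  iso: "move \<alpha> \<tau> S r p q"
    if "p \<in> nanophrases \<alpha> r" "q \<in> nanophrases \<alpha> r" "isomorphic p q"
| H1: "move \<alpha> \<tau> S r p q"
    if "p \<in> nanophrases \<alpha> r" "q \<in> nanophrases \<alpha> r"
       "written (words p) = x @ [Letter A, Letter A] @ y"
       "written (words q) = x @ y"
       "\<forall>X \<in> letters q. proj q X = proj p X"
| H2: "move \<alpha> \<tau> S r p q"
    if "p \<in> nanophrases \<alpha> r" "q \<in> nanophrases \<alpha> r"
       "written (words p) = x @ [Letter A, Letter B] @ y @ [Letter B, Letter A] @ z"
       "written (words q) = x @ y @ z"
       "proj p A = \<tau> (proj p B)"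
       "\<forall>X \<in> letters q. proj q X = proj p X"
| H3: "move \<alpha> \<tau> S r p q"
    if "p \<in> nanophrases \<alpha> r" "q \<in> nanophrases \<alpha> r"
       "written (words p) =
          x @ [Letter A, Letter B] @ y @ [Letter A, Letter C] @ z @ [Letter B, Letter C] @ t"
       "written (words q) =
          x @ [Letter B, Letter A] @ y @ [Letter C, Letter A] @ z @ [Letter C, Letter B] @ t"
       "(proj p A, proj p B, proj p C) \<in> S"
       "\<forall>X \<in> letters q. proj q X = proj p X"

definition homotopy ::
    "'a set \<Rightarrow> ('a \<Rightarrow> 'a) \<Rightarrow> ('a \<times> 'a \<times> 'a) set \<Rightarrow> nat \<Rightarrow> ('a nanophrase \<times> 'a nanophrase) set" where
  "homotopy \<alpha> \<tau> S r =
     {(p, q). p \<in> nanophrases \<alpha> r \<and> q \<in> nanophrases \<alpha> r \<and> equivclp (move \<alpha> \<tau> S r) p q}"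

definition homotopy_classes ::
    "'a set \<Rightarrow> ('a \<Rightarrow> 'a) \<Rightarrow> ('a \<times> 'a \<times> 'a) set \<Rightarrow> nat \<Rightarrow> 'a nanophrase set set" where
  "homotopy_classes \<alpha> \<tau> S r = nanophrases \<alpha> r // homotopy \<alpha> \<tau> S r"

definition homotopy_class ::
    "'a set \<Rightarrow> ('a \<Rightarrow> 'a) \<Rightarrow> ('a \<times> 'a \<times> 'a) set \<Rightarrow> nat \<Rightarrow> 'a nanophrase \<Rightarrow> 'a nanophrase set" where
  "homotopy_class \<alpha> \<tau> S r p = homotopy \<alpha> \<tau> S r `` {p}"

definition delete_letter :: "nat \<Rightarrow> 'a nanophrase \<Rightarrow> 'a nanophrase" where
  "delete_letter A p =
     Nanophrase (map (filter (\<lambda>X. X \<noteq> A)) (words p)) (restrict (proj p) (letters p - {A}))"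

text \<open>
  \<open>semi \<alpha> \<tau> S r As p\<close> is the nanophrase \<open>p\<close> with the letters in the list \<open>As\<close> (assumed
  distinct and occurring in \<open>p\<close>) marked as semi-letters, as an element of
  \<open>free_Abelian_group (homotopy_classes \<alpha> \<tau> S r)\<close>. The order of the list is the order in which the
  marks are expanded; it does not affect the result.
\<close>

fun semi :: "'a set \<Rightarrow> ('a \<Rightarrow> 'a) \<Rightarrow> ('a \<times> 'a \<times> 'a) set \<Rightarrow> nat \<Rightarrow> nat list \<Rightarrow> 'a nanophrase \<Rightarrow>
    'a nanophrase set \<Rightarrow>\<^sub>0 int" where
  "semi \<alpha> \<tau> S r [] p = frag_of (homotopy_class \<alpha> \<tau> S r p)"
| "semi \<alpha> \<tau> S r (A # As) p = semi \<alpha> \<tau> S r As p - semi \<alpha> \<tau> S r As (delete_letter A p)"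

definition linear_extension :: "('g, 'm) monoid_scheme \<Rightarrow> ('c \<Rightarrow> 'g) \<Rightarrow> ('c \<Rightarrow>\<^sub>0 int) \<Rightarrow> 'g" where
  "linear_extension G v c =
     finprod G (\<lambda>x. v x [^]\<^bsub>G\<^esub> Poly_Mapping.lookup c x) (Poly_Mapping.keys c)"

definition vanishes_above ::
    "'a set \<Rightarrow> ('a \<Rightarrow> 'a) \<Rightarrow> ('a \<times> 'a \<times> 'a) set \<Rightarrow> nat \<Rightarrow> ('g, 'm) monoid_scheme \<Rightarrow>
     ('a nanophrase set \<Rightarrow> 'g) \<Rightarrow> int \<Rightarrow> bool" where
  "vanishes_above \<alpha> \<tau> S r G v n \<longleftrightarrow>
     (\<forall>p \<in> nanophrases \<alpha> r. \<forall>As. distinct As \<and> set As \<subseteq> letters p \<and> n < int (length As) \<longrightarrow>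
        linear_extension G v (semi \<alpha> \<tau> S r As p) = \<one>\<^bsub>G\<^esub>)"

definition finite_type_invariant ::
    "'a set \<Rightarrow> ('a \<Rightarrow> 'a) \<Rightarrow> ('a \<times> 'a \<times> 'a) set \<Rightarrow> nat \<Rightarrow> ('g, 'm) monoid_scheme \<Rightarrow>
     ('a nanophrase set \<Rightarrow> 'g) \<Rightarrow> bool" where
  "finite_type_invariant \<alpha> \<tau> S r G v \<longleftrightarrow>
     v \<in> homotopy_classes \<alpha> \<tau> S r \<rightarrow> carrier G \<and> (\<exists>n. vanishes_above \<alpha> \<tau> S r G v n)"

definition invariant_degree ::
    "'a set \<Rightarrow> ('a \<Rightarrow> 'a) \<Rightarrow> ('a \<times> 'a \<times> 'a) set \<Rightarrow> nat \<Rightarrow> ('g, 'm) monoid_scheme \<Rightarrow>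
     ('a nanophrase set \<Rightarrow> 'g) \<Rightarrow> nat" where
  "invariant_degree \<alpha> \<tau> S r G v = (LEAST n. vanishes_above \<alpha> \<tau> S r G v (int n))"

text \<open>
  The group \<open>\<pi>\<close> is the quotient of the free abelian group on \<open>\<alpha>\<close> by the relators
  \<open>a + \<tau> a\<close>. As everywhere in HOL-Algebra, its operation is written multiplicatively, so the
  sums of the linking matrix become \<^const>\<open>finprod\<close>.
\<close>

definition pi_relators :: "'a set \<Rightarrow> ('a \<Rightarrow> 'a) \<Rightarrow> ('a \<Rightarrow>\<^sub>0 int) set" where
  "pi_relators \<alpha> \<tau> =
     generate (free_Abelian_group \<alpha>) {frag_of a + frag_of (\<tau> a) | a. a \<in> \<alpha>}"

definition pi_group :: "'a set \<Rightarrow> ('a \<Rightarrow> 'a) \<Rightarrow> ('a \<Rightarrow>\<^sub>0 int) set monoid" where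
  "pi_group \<alpha> \<tau> = free_Abelian_group \<alpha> Mod pi_relators \<alpha> \<tau>"

definition pi_gen :: "'a set \<Rightarrow> ('a \<Rightarrow> 'a) \<Rightarrow> 'a \<Rightarrow> ('a \<Rightarrow>\<^sub>0 int) set" where
  "pi_gen \<alpha> \<tau> a = pi_relators \<alpha> \<tau> #>\<^bsub>free_Abelian_group \<alpha>\<^esub> frag_of a"

definition letters_between :: "'a nanophrase \<Rightarrow> nat \<Rightarrow> nat \<Rightarrow> nat set" where
  "letters_between p i j =
     {X. \<exists>k l. (i, k) \<noteq> (j, l) \<and> k < length (words p ! i) \<and> l < length (words p ! j) \<and>
           words p ! i ! k = X \<and> words p ! j ! l = X}"

definition linking_number ::
    "'a set \<Rightarrow> ('a \<Rightarrow> 'a) \<Rightarrow> 'a nanophrase \<Rightarrow> nat \<Rightarrow> nat \<Rightarrow> ('a \<Rightarrow>\<^sub>0 int) set" where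
  "linking_number \<alpha> \<tau> p i j =
     (if i = j then \<one>\<^bsub>pi_group \<alpha> \<tau>\<^esub>
      else finprod (pi_group \<alpha> \<tau>) (\<lambda>X. pi_gen \<alpha> \<tau> (proj p X)) (letters_between p i j))"

text \<open>Components, hence rows and columns, are indexed by \<open>0, \<dots>, r - 1\<close>.\<close>

definition linking_matrix ::
    "'a set \<Rightarrow> ('a \<Rightarrow> 'a) \<Rightarrow> nat \<Rightarrow> 'a nanophrase \<Rightarrow> ('a \<Rightarrow>\<^sub>0 int) set mat" where
  "linking_matrix \<alpha> \<tau> r p = mat r r (\<lambda>(i, j). linking_number \<alpha> \<tau> p i j)"

end

theory Submission
  imports Defs
begin

text \<open>
  Let \<open>v\<close> be an invariant of degree one and read \<open>v\<close> of a phrase as a function of the set of letters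
  that are kept. Vanishing on phrases with two semi-letters says that every second difference of this
  function is trivial (\<open>val_second_difference\<close>), so the function is affine: \<open>v p\<close> is the value of the
  empty phrase times one factor for each letter \<open>X\<close> of \<open>p\<close>, namely the jump of \<open>v\<close> from the empty
  phrase to the phrase in which only \<open>X\<close> survives (\<open>val_eq_product_over_letters\<close>).

  A phrase with a single letter is determined up to isomorphism by the two components \<open>i\<close> and \<open>j\<close>
  that contain the letter and by its image \<open>a\<close> in \<open>\<alpha>\<close>; its factor is \<open>weight i j a\<close>. If \<open>i = j\<close>, the
  first move removes the letter and the factor is trivial. If \<open>i \<noteq> j\<close>, the second move removes a pair
  of letters with images \<open>\<tau> a\<close> and \<open>a\<close>, occurring as \<open>AB\<close> in component \<open>i\<close> and as \<open>BA\<close> in component \<open>j\<close>;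
  the product formula for that phrase then says that \<open>weight i j (\<tau> a)\<close> and \<open>weight i j a\<close> are inverse
  to each other (\<open>weight_relation\<close>).
  These are the defining relations of \<open>\<pi>\<close>, so \<open>weight i j\<close> extends to a homomorphism from \<open>\<pi>\<close>. It
  sends the linking number \<open>l\<^sub>i\<^sub>j p\<close> to the product of the factors of the letters between \<open>i\<close> and \<open>j\<close>.
  Hence the linking matrix determines every invariant of degree one.
\<close>

section \<open>Commutative groups\<close>

context comm_group
begin

text \<open>
  The discrete counterpart of the fact that a function with zero second derivative is affine:
  \<open>\<phi>\<close> is a function of the subsets of \<open>L\<close>, and the difference made by adding \<open>B\<close> to \<open>F\<close> stays the
  same when another element is added to \<open>F\<close>, so it equals the difference made by adding \<open>B\<close> to the
  empty set. The formula is then a telescoping product.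
\<close>

lemma product_formula_of_zero_second_difference:
  assumes "finite L"
    and closed: "\<And>F. F \<subseteq> L \<Longrightarrow> \<phi> F \<in> carrier G"
    and second_difference: "\<And>A B F. \<lbrakk>A \<in> L; B \<in> L; F \<subseteq> L; A \<notin> F; B \<notin> F; A \<noteq> B\<rbrakk> \<Longrightarrow>
          \<phi> (insert A (insert B F)) \<otimes> inv \<phi> (insert A F) = \<phi> (insert B F) \<otimes> inv \<phi> F"
  shows "\<phi> L = \<phi> {} \<otimes> (\<Otimes>X\<in>L. \<phi> {X} \<otimes> inv \<phi> {})"
proof -
  have difference: "\<phi> (insert B F) \<otimes> inv \<phi> F = \<phi> {B} \<otimes> inv \<phi> {}"
    if "F \<subseteq> L" "B \<in> L" "B \<notin> F" for B F
    using finite_subset[OF \<open>F \<subseteq> L\<close> \<open>finite L\<close>] that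
  proof (induction F rule: finite_induct)
    case (insert A F)
    then have "\<phi> (insert A (insert B F)) \<otimes> inv \<phi> (insert A F) = \<phi> (insert B F) \<otimes> inv \<phi> F"
      by (intro second_difference) auto
    with insert show ?case
      by (simp add: insert_commute)
  qed simp
  have "\<phi> F = \<phi> {} \<otimes> (\<Otimes>X\<in>F. \<phi> {X} \<otimes> inv \<phi> {})" if "F \<subseteq> L" for F
    using finite_subset[OF \<open>F \<subseteq> L\<close> \<open>finite L\<close>] that
  proof (induction F rule: finite_induct)
    case (insert B F)
    let ?d = "\<lambda>X. \<phi> {X} \<otimes> inv \<phi> {}"
    have d: "?d X \<in> carrier G" if "X \<in> insert B F" for X
      using that insert.prems closed[of "{X}"] closed[of "{}"] by auto
    then have prod: "finprod G ?d F \<in> carrier G"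
      by (intro finprod_closed) auto
    have \<phi>: "\<phi> (insert B F) \<in> carrier G" "\<phi> F \<in> carrier G" "\<phi> {} \<in> carrier G"
      using insert.prems closed by auto
    have "\<phi> (insert B F) \<otimes> inv \<phi> F = ?d B"
      using insert.hyps insert.prems by (intro difference) auto
    then have "\<phi> (insert B F) = ?d B \<otimes> \<phi> F"
      using \<phi> d[of B] by (metis insertI1 inv_solve_right m_closed inv_closed)
    also have "\<dots> = ?d B \<otimes> (\<phi> {} \<otimes> finprod G ?d F)"
      using insert.IH insert.prems by simp
    also have "\<dots> = \<phi> {} \<otimes> (?d B \<otimes> finprod G ?d F)"
      using \<phi> d prod by (intro m_lcomm) auto
    also have "?d B \<otimes> finprod G ?d F = finprod G ?d (insert B F)"
      using insert.hyps d by (subst finprod_insert) auto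
    finally show ?case .
  qed (use closed in simp)
  then show ?thesis
    by blast
qed

lemma hom_finprod:
  assumes "comm_group H" "h \<in> hom H G" "f \<in> A \<rightarrow> carrier H"
  shows "h (finprod H f A) = (\<Otimes>X\<in>A. h (f X))"
proof -
  interpret H: comm_group H by fact
  have one: "h \<one>\<^bsub>H\<^esub> = \<one>"
    using hom_one[OF assms(2)] by blast
  show ?thesis
    using \<open>f \<in> A \<rightarrow> carrier H\<close>
  proof (induction A rule: infinite_finite_induct)
    case (insert a A)
    then show ?case
      using assms(2) by (auto simp: hom_mult hom_in_carrier Pi_iff)
  qed (use one in auto)
qed

lemma linear_extension_superset:
  assumes "finite T" "Poly_Mapping.keys c \<subseteq> T" "v \<in> T \<rightarrow> carrier G"
  shows "linear_extension G v c = (\<Otimes>x\<in>T. v x [^] Poly_Mapping.lookup c x)"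
  unfolding linear_extension_def
  by (rule finprod_mono_neutral_cong_left)
     (use assms in \<open>auto simp: in_keys_iff\<close>)

lemma linear_extension_closed:
  assumes "v \<in> K \<rightarrow> carrier G" "Poly_Mapping.keys c \<subseteq> K"
  shows "linear_extension G v c \<in> carrier G"
  unfolding linear_extension_def using assms by (intro finprod_closed) auto

lemma linear_extension_frag_of:
  assumes "v x \<in> carrier G"
  shows "linear_extension G v (frag_of x) = v x"
  using assms by (simp add: linear_extension_superset[of "{x}"])

lemma linear_extension_diff:
  assumes v: "v \<in> K \<rightarrow> carrier G"
    and c: "Poly_Mapping.keys c \<subseteq> K" and d: "Poly_Mapping.keys d \<subseteq> K"
  shows "linear_extension G v (c - d) = linear_extension G v c \<otimes> inv linear_extension G v d"
proof -
  let ?T = "Poly_Mapping.keys c \<union> Poly_Mapping.keys d"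
  have T: "finite ?T" "v \<in> ?T \<rightarrow> carrier G"
    using assms by auto
  have "linear_extension G v (c - d) \<otimes> linear_extension G v d =
      (\<Otimes>x\<in>?T. v x [^] Poly_Mapping.lookup (c - d) x) \<otimes> (\<Otimes>x\<in>?T. v x [^] Poly_Mapping.lookup d x)"
    using T keys_diff[of c d] by (simp add: linear_extension_superset[of ?T])
  also have "\<dots> = (\<Otimes>x\<in>?T. v x [^] Poly_Mapping.lookup (c - d) x \<otimes> v x [^] Poly_Mapping.lookup d x)"
    using T by (subst finprod_multf) auto
  also have "\<dots> = (\<Otimes>x\<in>?T. v x [^] Poly_Mapping.lookup c x)"
  proof (rule finprod_cong')
    fix x
    assume "x \<in> ?T"
    then have "v x \<in> carrier G" using T by blast
    then show "v x [^] Poly_Mapping.lookup (c - d) x \<otimes> v x [^] Poly_Mapping.lookup d x =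
        v x [^] Poly_Mapping.lookup c x"
      by (simp flip: int_pow_mult add: lookup_minus)
  qed (use T in auto)
  also have "\<dots> = linear_extension G v c"
    using T by (simp add: linear_extension_superset[of ?T])
  finally have eq: "linear_extension G v (c - d) \<otimes> linear_extension G v d = linear_extension G v c" .
  have "Poly_Mapping.keys (c - d) \<subseteq> K"
    using keys_diff[of c d] c d by blast
  with v c d have "linear_extension G v (c - d) \<in> carrier G" "linear_extension G v c \<in> carrier G"
      "linear_extension G v d \<in> carrier G"
    by (auto intro: linear_extension_closed)
  with eq show ?thesis
    by (metis inv_solve_right)
qed

end


section \<open>The group \<open>\<pi>\<close>\<close>

lemma pi_relators_normal:
  assumes "\<tau> \<in> \<alpha> \<rightarrow> \<alpha>"
  shows "pi_relators \<alpha> \<tau> \<lhd> free_Abelian_group \<alpha>"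
proof -
  interpret F: comm_group "free_Abelian_group \<alpha>"
    by (rule abelian_free_Abelian_group)
  show ?thesis
    unfolding pi_relators_def using assms
    by (intro F.subgroup_imp_normal F.generate_is_subgroup)
       (auto dest!: set_mp[OF Poly_Mapping.keys_add] simp: Pi_iff)
qed

lemma comm_group_pi_group:
  assumes "\<tau> \<in> \<alpha> \<rightarrow> \<alpha>"
  shows "comm_group (pi_group \<alpha> \<tau>)"
proof -
  interpret F: comm_group "free_Abelian_group \<alpha>"
    by (rule abelian_free_Abelian_group)
  show ?thesis
    unfolding pi_group_def
    using F.abelian_FactGroup normal_imp_subgroup[OF pi_relators_normal[OF assms]] by blast
qed

lemma pi_gen_closed: "a \<in> \<alpha> \<Longrightarrow> pi_gen \<alpha> \<tau> a \<in> carrier (pi_group \<alpha> \<tau>)"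
  by (auto simp: pi_gen_def pi_group_def carrier_FactGroup)

text \<open>
  A map on \<open>\<alpha>\<close> extends to the free abelian group; the relation puts the generators of
  \<open>pi_relators \<alpha> \<tau>\<close> into the kernel of the extension, which therefore factors through the quotient.
\<close>

lemma (in comm_group) pi_group_universal:
  assumes \<tau>: "\<tau> \<in> \<alpha> \<rightarrow> \<alpha>" and g: "g \<in> \<alpha> \<rightarrow> carrier G"
    and relation: "\<And>a. a \<in> \<alpha> \<Longrightarrow> g a \<otimes> g (\<tau> a) = \<one>"
  obtains h where "h \<in> hom (pi_group \<alpha> \<tau>) G" "\<And>a. a \<in> \<alpha> \<Longrightarrow> h (pi_gen \<alpha> \<tau> a) = g a"
proof -
  obtain \<phi> where \<phi>: "\<phi> \<in> hom (free_Abelian_group \<alpha>) G" "\<And>a. a \<in> \<alpha> \<Longrightarrow> \<phi> (frag_of a) = g a"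
    using free_Abelian_group_universal[of g \<alpha>] g by blast
  interpret \<phi>: group_hom "free_Abelian_group \<alpha>" G \<phi>
    by (simp add: \<phi>(1) group_hom_axioms.intro group_hom.intro)
  have "pi_relators \<alpha> \<tau> \<subseteq> kernel (free_Abelian_group \<alpha>) G \<phi>"
    unfolding pi_relators_def
  proof (rule \<phi>.G.generate_subgroup_incl[OF _ \<phi>.subgroup_kernel])
    have "frag_of a + frag_of (\<tau> a) \<in> kernel (free_Abelian_group \<alpha>) G \<phi>" if "a \<in> \<alpha>" for a
    proof -
      have "\<tau> a \<in> \<alpha>" using \<tau> that by auto
      moreover have "\<phi> (frag_of a + frag_of (\<tau> a)) = \<phi> (frag_of a) \<otimes> \<phi> (frag_of (\<tau> a))"
        using \<phi>.hom_mult[of "frag_of a" "frag_of (\<tau> a)"] that \<open>\<tau> a \<in> \<alpha>\<close> by simp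
      ultimately show ?thesis
        using that \<phi>(2) relation \<phi>.G.m_closed[of "frag_of a" "frag_of (\<tau> a)"]
        by (simp add: kernel_def)
    qed
    then show "{frag_of a + frag_of (\<tau> a) |a. a \<in> \<alpha>} \<subseteq> kernel (free_Abelian_group \<alpha>) G \<phi>"
      by blast
  qed
  with \<phi>.FactGroup_universal_kernel[OF pi_relators_normal[OF \<tau>]]
  obtain h where "h \<in> hom (pi_group \<alpha> \<tau>) G"
      "\<And>x. x \<in> carrier (free_Abelian_group \<alpha>) \<Longrightarrow> h (pi_relators \<alpha> \<tau> #>\<^bsub>free_Abelian_group \<alpha>\<^esub> x) = \<phi> x"
    unfolding pi_group_def by blast
  with \<phi>(2) that show thesis
    by (simp add: pi_gen_def)
qed

section \<open>Occurrences of a letter\<close>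

lemma count_list_concat: "count_list (concat ws) A = (\<Sum>k<length ws. count_list (ws ! k) A)"
proof -
  have "count_list (concat ws) A = sum_list (map (\<lambda>w. count_list w A) ws)"
    by (induction ws) auto
  then show ?thesis
    by (simp add: sum_list_sum_nth atLeast0LessThan)
qed

lemma count_list_filter: "count_list (filter P xs) A = (if P A then count_list xs A else 0)"
  by (induction xs) auto

lemma filter_singleton: "filter (\<lambda>Y. Y \<in> {X}) w = replicate (count_list w X) X"
  by (induction w) auto

lemma count_list_replicate: "count_list (replicate n X) Y = (if X = Y then n else 0)"
  by (induction n) auto

text \<open>
  Connects the Gauss condition, stated by counting, with \<open>letters_between\<close>, stated by positions:
  a component contains both occurrences of a letter exactly if two positions carry it.
\<close>

lemma two_le_count_list_iff:
  "2 \<le> count_list w X \<longleftrightarrow> (\<exists>k l. k \<noteq> l \<and> k < length w \<and> l < length w \<and> w ! k = X \<and> w ! l = X)"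
proof -
  have two: "2 \<le> card {k. P k} \<longleftrightarrow> (\<exists>k l. k \<noteq> l \<and> P k \<and> P l)" if "finite {k. P k}" for P :: "nat \<Rightarrow> bool"
  proof -
    have "2 \<le> card {k. P k} \<longleftrightarrow> \<not> card {k. P k} \<le> Suc 0"
      by linarith
    with card_le_Suc0_iff_eq[OF that] show ?thesis
      by (simp only: mem_Collect_eq Ball_def) blast
  qed
  have "count_list w X = card {k. k < length w \<and> w ! k = X}"
    by (simp add: count_list_eq_length_filter length_filter_conv_card eq_commute)
  then have "2 \<le> count_list w X \<longleftrightarrow>
      (\<exists>k l. k \<noteq> l \<and> (k < length w \<and> w ! k = X) \<and> (l < length w \<and> w ! l = X))"
    using two[of "\<lambda>k. k < length w \<and> w ! k = X"] by simp
  then show ?thesis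
    by (simp only: conj_ac)
qed

text \<open>
  Applied to the number of occurrences of a letter in each component. Writing the counts as a sum
  of two indicators covers \<open>i = j\<close>, where a component contains the letter twice, together with
  \<open>i < j\<close>, and so avoids a case distinction in most of what follows.
\<close>

lemma sum_eq_2_cases:
  fixes c :: "nat \<Rightarrow> nat"
  assumes "(\<Sum>k<r. c k) = 2"
  shows "\<exists>i j. i \<le> j \<and> j < r \<and> (\<forall>k<r. c k = of_bool (k = i) + of_bool (k = j))"
  using assms
proof (induction r)
  case (Suc r)
  then have sum: "(\<Sum>k<r. c k) + c r = 2" by simp
  then consider "c r = 0" | "c r = 1" | "c r = 2" by linarith
  then show ?case
  proof cases
    case 1
    with sum Suc.IH obtain i j where
      "i \<le> j" "j < r" "\<forall>k<r. c k = of_bool (k = i) + of_bool (k = j)"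
      by auto
    with 1 show ?thesis
      by (intro exI[of _ i] exI[of _ j]) (auto simp: less_Suc_eq)
  next
    case 2
    with sum have "(\<Sum>k<r. c k) = 1" by simp
    then obtain i where "i < r" "c i = 1" "\<forall>k<r. i \<noteq> k \<longrightarrow> c k = 0"
      using sum_eq_1_iff[of "{..<r}" c] by auto
    with 2 show ?thesis
      by (intro exI[of _ i] exI[of _ r]) (auto simp: less_Suc_eq)
  next
    case 3
    with sum have "\<forall>k<r. c k = 0" by simp
    with 3 show ?thesis
      by (intro exI[of _ r]) (auto simp: less_Suc_eq)
  qed
qed simp

text \<open>
  Isolates one component of a written phrase. The two \<open>concat\<close> terms do not depend on the word \<open>w\<close>,
  so a move inside a component replaces only the middle part.
\<close>

lemma written_component:
  "written (us @ w # vs) =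
     concat (map (\<lambda>u. map Letter u @ [Bar]) us) @ map Letter w @ concat (map (\<lambda>v. Bar # map Letter v) vs)"
proof (induction us)
  case Nil
  show ?case
    by (induction vs arbitrary: w) auto
next
  case (Cons u us)
  obtain x xs where "us @ w # vs = x # xs"
    by (cases us) auto
  then have "written ((u # us) @ w # vs) = map Letter u @ [Bar] @ written (us @ w # vs)"
    by simp
  with Cons show ?case
    by simp
qed

section \<open>Subphrases and phrases with one letter\<close>

definition empty_phrase :: "nat \<Rightarrow> 'a nanophrase" where
  "empty_phrase r = Nanophrase (map (\<lambda>_. []) [0..<r]) (\<lambda>_. undefined)"

text \<open>
  The phrase whose only letter \<open>X\<close>, with image \<open>a\<close>, has one occurrence in component \<open>i\<close> and one in
  component \<open>j\<close>; for \<open>i = j\<close> that component is the word \<open>XX\<close>.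
\<close>

definition chord_phrase :: "nat \<Rightarrow> nat \<Rightarrow> nat \<Rightarrow> nat \<Rightarrow> 'a \<Rightarrow> 'a nanophrase" where
  "chord_phrase r i j X a =
     Nanophrase (map (\<lambda>k. replicate (of_bool (k = i) + of_bool (k = j)) X) [0..<r]) (\<lambda>Y\<in>{X}. a)"

definition restrict_letters :: "nat set \<Rightarrow> 'a nanophrase \<Rightarrow> 'a nanophrase" where
  "restrict_letters F p =
     Nanophrase (map (filter (\<lambda>X. X \<in> F)) (words p)) (restrict (proj p) (letters p \<inter> F))"

lemma finite_letters [simp]: "finite (letters p)"
  by (simp add: letters_def)

lemma letters_restrict_letters [simp]: "letters (restrict_letters F p) = letters p \<inter> F"
  by (auto simp: letters_def restrict_letters_def)

lemma restrict_letters_nanophrase: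
  assumes "p \<in> nanophrases \<alpha> r"
  shows "restrict_letters F p \<in> nanophrases \<alpha> r"
proof -
  have "gauss_phrase r (words (restrict_letters F p))"
    using assms
    by (auto simp: restrict_letters_def nanophrases_def gauss_phrase_def count_list_filter
        simp flip: filter_concat)
  moreover have "proj (restrict_letters F p) \<in> letters p \<inter> F \<rightarrow>\<^sub>E \<alpha>"
    using assms by (auto simp: restrict_letters_def nanophrases_def)
  ultimately show ?thesis
    by (simp add: nanophrases_def)
qed

lemma restrict_letters_all:
  assumes "p \<in> nanophrases \<alpha> r"
  shows "restrict_letters (letters p) p = p"
proof (rule nanophrase.expand)
  have "map (filter (\<lambda>X. X \<in> letters p)) (words p) = words p"
    by (rule map_idI, rule filter_True) (auto simp: letters_def)
  moreover have "restrict (proj p) (letters p) = proj p"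
    using assms by (auto simp: nanophrases_def intro: extensional_restrict)
  ultimately show "words (restrict_letters (letters p) p) = words p \<and>
      proj (restrict_letters (letters p) p) = proj p"
    by (simp add: restrict_letters_def)
qed

lemma delete_letter_restrict_letters:
  "delete_letter A (restrict_letters F p) = restrict_letters (F - {A}) p"
proof -
  have "letters p \<inter> F \<inter> (letters p \<inter> F - {A}) = letters p \<inter> (F - {A})" by auto
  moreover have "letters (Nanophrase (map (filter (\<lambda>X. X \<in> F)) (words p)) f) = letters p \<inter> F" for f :: "nat \<Rightarrow> 'a"
    by (auto simp: letters_def)
  ultimately show ?thesis
    by (simp add: delete_letter_def restrict_letters_def conj_commute cong: conj_cong)
qed

lemma delete_letter_nanophrase:
  assumes "p \<in> nanophrases \<alpha> r"
  shows "delete_letter A p \<in> nanophrases \<alpha> r"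
proof -
  have "delete_letter A p = restrict_letters (letters p - {A}) p"
    using delete_letter_restrict_letters[of A "letters p" p] restrict_letters_all[OF assms] by simp
  with restrict_letters_nanophrase[OF assms] show ?thesis by simp
qed

lemma restrict_letters_empty:
  assumes "p \<in> nanophrases \<alpha> r"
  shows "restrict_letters {} p = empty_phrase r"
  using assms
  by (auto simp: restrict_letters_def empty_phrase_def nanophrases_def gauss_phrase_def restrict_def
      intro!: nth_equalityI)

lemma restrict_letters_single:
  assumes "p \<in> nanophrases \<alpha> r" "X \<in> letters p"
    and "\<forall>k<r. count_list (words p ! k) X = of_bool (k = i) + of_bool (k = j)"
  shows "restrict_letters {X} p = chord_phrase r i j X (proj p X)"
proof -
  have "length (words p) = r"
    using assms by (simp add: nanophrases_def gauss_phrase_def)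
  then have "map (filter (\<lambda>Y. Y \<in> {X})) (words p) =
      map (\<lambda>k. replicate (of_bool (k = i) + of_bool (k = j)) X) [0..<r]"
    unfolding filter_singleton by (intro nth_equalityI) (auto simp: assms(3))
  moreover have "restrict (proj p) (letters p \<inter> {X}) = (\<lambda>Y\<in>{X}. proj p X)"
    using assms(2) by (auto simp: restrict_def)
  ultimately show ?thesis
    by (simp only: restrict_letters_def chord_phrase_def)
qed

lemma letters_chord_phrase:
  assumes "i < r"
  shows "letters (chord_phrase r i j X a) = {X}"
  using assms by (auto simp: letters_def chord_phrase_def intro!: bexI[of _ i])

lemma chord_phrase_nanophrase:
  assumes "i < r" "j < r" "a \<in> \<alpha>"
  shows "chord_phrase r i j X a \<in> nanophrases \<alpha> r"
proof -
  let ?p = "chord_phrase r i j X a"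
  have "count_list (concat (words ?p)) X = (\<Sum>k<r. of_bool (k = i) + of_bool (k = j))"
    by (simp add: count_list_concat chord_phrase_def count_list_replicate)
  also have "\<dots> = 2"
    using assms by (simp add: sum.distrib of_bool_def)
  finally have "count_list (concat (words ?p)) X = 2" .
  moreover have "set (concat (words ?p)) = {X}"
    using letters_chord_phrase[OF \<open>i < r\<close>, of j X a] by (simp only: letters_def)
  ultimately have "gauss_phrase r (words ?p)"
    by (simp add: gauss_phrase_def) (simp add: chord_phrase_def)
  then show ?thesis
    using assms by (simp add: nanophrases_def letters_chord_phrase) (simp add: chord_phrase_def)
qed

lemma isomorphic_chord_phrases:
  assumes "i < r" "j < r"
  shows "isomorphic (chord_phrase r i j X a) (chord_phrase r i j Y a)"
  unfolding isomorphic_def using assms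
  by (intro exI[of _ "\<lambda>_. Y"]) (auto simp: letters_chord_phrase, auto simp: chord_phrase_def map_replicate_const)

lemma letters_cases:
  assumes "p \<in> nanophrases \<alpha> r" "X \<in> letters p"
  obtains i j where "i \<le> j" "j < r"
    "\<forall>k<r. count_list (words p ! k) X = of_bool (k = i) + of_bool (k = j)"
proof -
  have "(\<Sum>k<r. count_list (words p ! k) X) = 2"
    using assms by (auto simp: nanophrases_def gauss_phrase_def letters_def simp flip: count_list_concat)
  from sum_eq_2_cases[OF this] that show thesis
    by blast
qed

text \<open>
  Each letter lies between exactly one pair of components \<open>i \<le> j\<close>. The value for \<open>i' = j'\<close> relies on
  \<open>letters_between\<close> asking for two different positions when its two indices coincide.
\<close>

lemma letters_between_iff:
  assumes "i \<le> j" "j < r" "i' \<le> j'" "j' < r"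
    and count: "\<forall>k<r. count_list (words p ! k) X = of_bool (k = i) + of_bool (k = j)"
  shows "X \<in> letters_between p i' j' \<longleftrightarrow> i' = i \<and> j' = j"
proof (cases "i' = j'")
  case True
  have "X \<in> letters_between p i' j' \<longleftrightarrow> 2 \<le> count_list (words p ! j') X"
    unfolding letters_between_def two_le_count_list_iff using True by auto
  then show ?thesis
    using count assms True by (auto simp: of_bool_def split: if_splits)
next
  case False
  then have "X \<in> letters_between p i' j' \<longleftrightarrow> X \<in> set (words p ! i') \<and> X \<in> set (words p ! j')"
    by (auto simp: letters_between_def in_set_conv_nth)
  also have "\<dots> \<longleftrightarrow> count_list (words p ! i') X \<noteq> 0 \<and> count_list (words p ! j') X \<noteq> 0"
    by (simp add: count_list_0_iff)
  finally show ?thesis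
    using count assms False by (auto simp: of_bool_def split: if_splits)
qed

lemma letters_between_subset:
  assumes "p \<in> nanophrases \<alpha> r" "i < r"
  shows "letters_between p i j \<subseteq> letters p"
proof
  fix X
  assume "X \<in> letters_between p i j"
  then have "X \<in> set (words p ! i)"
    unfolding letters_between_def by (blast intro: nth_mem)
  moreover have "words p ! i \<in> set (words p)"
    using assms by (simp add: nanophrases_def gauss_phrase_def)
  ultimately show "X \<in> letters p"
    unfolding letters_def set_concat by (rule UN_I[rotated])
qed

lemma letters_eq_UN_letters_between:
  assumes "p \<in> nanophrases \<alpha> r"
  shows "letters p = (\<Union>(i, j)\<in>{(i, j). i \<le> j \<and> j < r}. letters_between p i j)"
proof
  show "letters p \<subseteq> (\<Union>(i, j)\<in>{(i, j). i \<le> j \<and> j < r}. letters_between p i j)"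
  proof
    fix X
    assume "X \<in> letters p"
    with assms obtain i j where ij: "i \<le> j" "j < r"
      "\<forall>k<r. count_list (words p ! k) X = of_bool (k = i) + of_bool (k = j)"
      by (rule letters_cases)
    with letters_between_iff[OF ij(1,2) ij(1,2) ij(3)]
    show "X \<in> (\<Union>(i, j)\<in>{(i, j). i \<le> j \<and> j < r}. letters_between p i j)"
      by auto
  qed
  show "(\<Union>(i, j)\<in>{(i, j). i \<le> j \<and> j < r}. letters_between p i j) \<subseteq> letters p"
  proof clarify
    fix X i j
    assume "X \<in> letters_between p i j" "i \<le> j" "j < r"
    with letters_between_subset[OF assms, of i j] show "X \<in> letters p"
      by auto
  qed
qed

section \<open>Homotopies between small nanophrases\<close>

lemma homotopy_class_eq_of_move:
  assumes "p \<in> nanophrases \<alpha> r" "q \<in> nanophrases \<alpha> r" "move \<alpha> \<tau> S r p q"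
  shows "homotopy_class \<alpha> \<tau> S r p = homotopy_class \<alpha> \<tau> S r q"
proof -
  have "equivclp (move \<alpha> \<tau> S r) p q"
    using assms(3) by (rule r_into_equivclp)
  then have "equivclp (move \<alpha> \<tau> S r) p s \<longleftrightarrow> equivclp (move \<alpha> \<tau> S r) q s" for s
    using equivclp_sym equivclp_trans by metis
  with assms(1,2) show ?thesis
    by (auto simp: homotopy_class_def homotopy_def)
qed

lemma homotopy_class_closed:
  "p \<in> nanophrases \<alpha> r \<Longrightarrow> homotopy_class \<alpha> \<tau> S r p \<in> homotopy_classes \<alpha> \<tau> S r"
  by (simp add: homotopy_class_def homotopy_classes_def quotientI)

lemma upt_split:
  assumes "m \<le> i" "i < r"
  shows "[m..<r] = [m..<i] @ i # [Suc i..<r]"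
  using assms upt_add_eq_append[of m i "r - i"] by (simp add: upt_conv_Cons)

lemma letters_empty_phrase: "letters (empty_phrase r) = {}"
  by (auto simp: letters_def empty_phrase_def)

lemma empty_phrase_nanophrase: "empty_phrase r \<in> nanophrases \<alpha> r"
  by (auto simp: empty_phrase_def nanophrases_def gauss_phrase_def letters_def)

lemma homotopy_class_chord_phrase:
  assumes "i < r" "j < r" "a \<in> \<alpha>"
  shows "homotopy_class \<alpha> \<tau> S r (chord_phrase r i j X a) = homotopy_class \<alpha> \<tau> S r (chord_phrase r i j Y a)"
  using assms
  by (intro homotopy_class_eq_of_move move.iso chord_phrase_nanophrase isomorphic_chord_phrases)

text \<open>
  An instance of the first move: component \<open>i\<close> of \<open>chord_phrase r i i X a\<close> is the word \<open>XX\<close>.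
\<close>

lemma homotopy_class_self_chord:
  fixes \<alpha> :: "'a set"
  assumes "i < r" "a \<in> \<alpha>"
  shows "homotopy_class \<alpha> \<tau> S r (chord_phrase r i i X a) = homotopy_class \<alpha> \<tau> S r (empty_phrase r)"
proof (intro homotopy_class_eq_of_move move.H1)
  let ?us = "map (\<lambda>_. []) [0..<i]" and ?vs = "map (\<lambda>_. []) [Suc i..<r]"
  let ?x = "concat (map (\<lambda>u. map Letter u @ [Bar]) ?us)"
    and ?y = "concat (map (\<lambda>v. Bar # map Letter v) ?vs)"
  have "words (chord_phrase r i i X a) = ?us @ [X, X] # ?vs"
    using assms by (simp add: chord_phrase_def upt_split[of 0 i r] numeral_2_eq_2)
  then show "written (words (chord_phrase r i i X a)) = ?x @ [Letter X, Letter X] @ ?y"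
    by (simp only: written_component) simp
  have "words (empty_phrase r :: 'a nanophrase) = ?us @ [] # ?vs"
    using assms by (simp add: empty_phrase_def upt_split[of 0 i r])
  then show "written (words (empty_phrase r :: 'a nanophrase)) = ?x @ ?y"
    by (simp only: written_component) simp
qed (use assms in \<open>simp_all add: chord_phrase_nanophrase empty_phrase_nanophrase letters_empty_phrase\<close>)

text \<open>
  The phrase with the word \<open>AB\<close> in component \<open>i\<close> and \<open>BA\<close> in component \<open>j\<close>, where \<open>A = 0\<close> and \<open>B = 1\<close>
  have images \<open>a\<close> and \<open>b\<close>. If \<open>a = \<tau> b\<close>, the second move removes both letters at once, whereas
  deleting one of them leaves a single letter between \<open>i\<close> and \<open>j\<close>.
\<close>

definition antiparallel_chords :: "nat \<Rightarrow> nat \<Rightarrow> nat \<Rightarrow> 'a \<Rightarrow> 'a \<Rightarrow> 'a nanophrase" where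
  "antiparallel_chords r i j a b =
     Nanophrase (map (\<lambda>k. if k = i then [0, 1] else if k = j then [1, 0] else []) [0..<r])
       (\<lambda>X\<in>{0, 1}. if X = 0 then a else b)"

lemma proj_antiparallel_chords:
  "proj (antiparallel_chords r i j a b) 0 = a" "proj (antiparallel_chords r i j a b) (Suc 0) = b"
  by (simp_all add: antiparallel_chords_def)

context
  fixes r i j :: nat
  assumes ij: "i < j" "j < r"
begin

lemma words_antiparallel_chords:
  "words (antiparallel_chords r i j a b) =
     map (\<lambda>_. []) [0..<i] @ [0, 1] # map (\<lambda>_. []) [Suc i..<j] @ [1, 0] # map (\<lambda>_. []) [Suc j..<r]"
  using ij by (simp add: antiparallel_chords_def upt_split[of 0 i r] upt_split[of "Suc i" j r])

lemma letters_antiparallel_chords: "letters (antiparallel_chords r i j a b) = {0, 1}"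
  by (auto simp: letters_def words_antiparallel_chords)

lemma count_antiparallel_chords:
  assumes "k < r" "X \<in> {0, 1}"
  shows "count_list (words (antiparallel_chords r i j a b) ! k) X = of_bool (k = i) + of_bool (k = j)"
  using assms ij by (auto simp: antiparallel_chords_def)

lemma antiparallel_chords_nanophrase:
  assumes "a \<in> \<alpha>" "b \<in> \<alpha>"
  shows "antiparallel_chords r i j a b \<in> nanophrases \<alpha> r"
proof -
  have "count_list (concat (words (antiparallel_chords r i j a b))) X = 2" if "X \<in> {0, 1}" for X
    using that by (auto simp: words_antiparallel_chords comp_def)
  moreover have "set (concat (words (antiparallel_chords r i j a b))) = {0, 1}"
    using letters_antiparallel_chords[of a b] by (simp only: letters_def)
  moreover have "length (words (antiparallel_chords r i j a b)) = r"
    by (simp add: antiparallel_chords_def)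
  ultimately have "gauss_phrase r (words (antiparallel_chords r i j a b))"
    by (simp only: gauss_phrase_def) simp
  moreover have "proj (antiparallel_chords r i j a b) \<in> {0, 1} \<rightarrow>\<^sub>E \<alpha>"
    using assms by (simp add: antiparallel_chords_def)
  ultimately show ?thesis
    by (simp add: nanophrases_def letters_antiparallel_chords)
qed

lemma homotopy_class_antiparallel_chords:
  fixes \<alpha> :: "'a set"
  assumes "a \<in> \<alpha>" "b \<in> \<alpha>" "a = \<tau> b"
  shows "homotopy_class \<alpha> \<tau> S r (antiparallel_chords r i j a b) = homotopy_class \<alpha> \<tau> S r (empty_phrase r)"
proof (intro homotopy_class_eq_of_move move.H2)
  let ?us = "map (\<lambda>_. []) [0..<i]" and ?ms = "map (\<lambda>_. []) [Suc i..<j]" and ?vs = "map (\<lambda>_. []) [Suc j..<r]"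
  let ?x = "concat (map (\<lambda>u. map Letter u @ [Bar]) ?us)"
    and ?y = "concat (map (\<lambda>v. Bar # map Letter v) ?ms) @ [Bar]"
    and ?z = "concat (map (\<lambda>v. Bar # map Letter v) ?vs)"
  show "written (words (antiparallel_chords r i j a b)) =
      ?x @ [Letter 0, Letter 1] @ ?y @ [Letter 1, Letter 0] @ ?z"
    by (simp only: words_antiparallel_chords written_component) simp
  have "words (empty_phrase r :: 'a nanophrase) = ?us @ [] # ?ms @ [] # ?vs"
    using ij by (simp add: empty_phrase_def upt_split[of 0 i r] upt_split[of "Suc i" j r])
  then show "written (words (empty_phrase r :: 'a nanophrase)) = ?x @ ?y @ ?z"
    by (simp only: written_component) simp
qed (use assms in \<open>simp_all add: antiparallel_chords_nanophrase empty_phrase_nanophrase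
      letters_empty_phrase proj_antiparallel_chords\<close>)

end

section \<open>Invariants of degree one\<close>

text \<open>
  The conditions on \<open>v\<close> say that its degree is at most one: expanding all but two of the semi-letters
  of a phrase writes it as a combination of phrases with exactly two semi-letters.
\<close>

locale degree_one_invariant = comm_group G
  for G :: "('g, 'm) monoid_scheme" (structure) +
  fixes \<alpha> :: "'a set" and \<tau> :: "'a \<Rightarrow> 'a" and S :: "('a \<times> 'a \<times> 'a) set" and r :: nat
    and v :: "'a nanophrase set \<Rightarrow> 'g"
  assumes \<tau>_closed: "\<tau> \<in> \<alpha> \<rightarrow> \<alpha>"
    and v_closed: "v \<in> homotopy_classes \<alpha> \<tau> S r \<rightarrow> carrier G"
    and vanishes: "\<lbrakk>p \<in> nanophrases \<alpha> r; A \<in> letters p; B \<in> letters p; A \<noteq> B\<rbrakk> \<Longrightarrow>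
          linear_extension G v (semi \<alpha> \<tau> S r [A, B] p) = \<one>"
begin

definition val :: "'a nanophrase \<Rightarrow> 'g" where
  "val p = v (homotopy_class \<alpha> \<tau> S r p)"

lemma val_closed: "p \<in> nanophrases \<alpha> r \<Longrightarrow> val p \<in> carrier G"
  using v_closed homotopy_class_closed unfolding val_def by (rule funcset_mem)

text \<open>
  The expansion of a phrase with the semi-letters \<open>A\<close> and \<open>B\<close>, with the four terms distributed over
  the two sides so that it compares the effect of deleting \<open>B\<close> before and after deleting \<open>A\<close>.
\<close>

lemma val_second_difference:
  assumes "p \<in> nanophrases \<alpha> r" "A \<in> letters p" "B \<in> letters p" "A \<noteq> B"
  shows "val p \<otimes> inv val (delete_letter B p) =
    val (delete_letter A p) \<otimes> inv val (delete_letter B (delete_letter A p))"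
proof -
  let ?c = "\<lambda>p. frag_of (homotopy_class \<alpha> \<tau> S r p)"
  let ?ext = "linear_extension G v"
  have extend: "?ext (?c q - ?c q') = val q \<otimes> inv val q'"
    and keys: "Poly_Mapping.keys (?c q - ?c q') \<subseteq> homotopy_classes \<alpha> \<tau> S r"
    if "q \<in> nanophrases \<alpha> r" "q' \<in> nanophrases \<alpha> r" for q q'
  proof -
    have mem: "homotopy_class \<alpha> \<tau> S r q \<in> homotopy_classes \<alpha> \<tau> S r"
      "homotopy_class \<alpha> \<tau> S r q' \<in> homotopy_classes \<alpha> \<tau> S r"
      using that by (simp_all add: homotopy_class_closed)
    with that show "?ext (?c q - ?c q') = val q \<otimes> inv val q'"
      by (subst linear_extension_diff[OF v_closed])
         (simp_all add: linear_extension_frag_of val_closed flip: val_def)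
    show "Poly_Mapping.keys (?c q - ?c q') \<subseteq> homotopy_classes \<alpha> \<tau> S r"
      using mem by (intro order_trans[OF keys_diff]) simp
  qed
  note nano = assms(1) delete_letter_nanophrase
  have "\<one> = ?ext ((?c p - ?c (delete_letter B p)) -
      (?c (delete_letter A p) - ?c (delete_letter B (delete_letter A p))))"
    using vanishes[OF assms] by simp
  also have "\<dots> = (val p \<otimes> inv val (delete_letter B p)) \<otimes>
      inv (val (delete_letter A p) \<otimes> inv val (delete_letter B (delete_letter A p)))"
    by (subst linear_extension_diff[OF v_closed]) (simp_all add: keys extend nano)
  finally show ?thesis
    by (metis val_closed nano inv_closed m_closed one_closed inv_solve_right l_one)
qed

text \<open>
  Keeping the letters in \<open>F\<close> is a function of \<open>F\<close> with values in \<open>G\<close>, and its second differences are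
  those of the previous lemma, because deleting a letter from a subphrase gives a subphrase again.
\<close>

lemma val_eq_product_over_letters:
  assumes p: "p \<in> nanophrases \<alpha> r"
  shows "val p = val (empty_phrase r) \<otimes>
    (\<Otimes>X\<in>letters p. val (restrict_letters {X} p) \<otimes> inv val (empty_phrase r))"
proof -
  have "val (restrict_letters (letters p) p) = val (restrict_letters {} p) \<otimes>
    (\<Otimes>X\<in>letters p. val (restrict_letters {X} p) \<otimes> inv val (restrict_letters {} p))"
  proof (rule product_formula_of_zero_second_difference)
    fix A B F
    assume "A \<in> letters p" "B \<in> letters p" "F \<subseteq> letters p" "A \<notin> F" "B \<notin> F" "A \<noteq> B"
    moreover from this have "insert A (insert B F) - {B} = insert A F"
      "insert A (insert B F) - {A} = insert B F" "insert B F - {B} = F"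
      by auto
    ultimately show "val (restrict_letters (insert A (insert B F)) p) \<otimes> inv val (restrict_letters (insert A F) p) =
        val (restrict_letters (insert B F) p) \<otimes> inv val (restrict_letters F p)"
      using val_second_difference[of "restrict_letters (insert A (insert B F)) p" A B]
      by (simp add: restrict_letters_nanophrase[OF p] delete_letter_restrict_letters)
  qed (simp_all add: val_closed restrict_letters_nanophrase[OF p])
  then show ?thesis
    by (simp add: restrict_letters_all[OF p] restrict_letters_empty[OF p])
qed

definition weight :: "nat \<Rightarrow> nat \<Rightarrow> 'a \<Rightarrow> 'g" where
  "weight i j a = val (chord_phrase r i j 0 a) \<otimes> inv val (empty_phrase r)"

lemma weight_closed: "\<lbrakk>i < r; j < r; a \<in> \<alpha>\<rbrakk> \<Longrightarrow> weight i j a \<in> carrier G"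
  by (simp add: weight_def val_closed chord_phrase_nanophrase empty_phrase_nanophrase)

text \<open>
  The letter \<open>X\<close> alone forms a phrase isomorphic to the one in \<open>weight\<close>, whose letter is \<open>0\<close>.
\<close>

lemma letter_contribution:
  assumes p: "p \<in> nanophrases \<alpha> r" and X: "X \<in> letters p" and ij: "i < r" "j < r"
    and count: "\<forall>k<r. count_list (words p ! k) X = of_bool (k = i) + of_bool (k = j)"
  shows "val (restrict_letters {X} p) \<otimes> inv val (empty_phrase r) = weight i j (proj p X)"
proof -
  have "proj p X \<in> \<alpha>"
    using p X by (auto simp: nanophrases_def)
  then show ?thesis
    using homotopy_class_chord_phrase[OF ij, of "proj p X" \<alpha> \<tau> S X 0]
    by (simp add: weight_def val_def restrict_letters_single[OF p X count])
qed

lemma weight_self: "\<lbrakk>i < r; a \<in> \<alpha>\<rbrakk> \<Longrightarrow> weight i i a = \<one>"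
  using homotopy_class_self_chord[of i r a \<alpha> \<tau> S 0] val_closed[OF empty_phrase_nanophrase]
  by (simp add: weight_def val_def)

text \<open>
  The product formula for the antiparallel chords has two factors, one for each letter, and by the
  second move its left-hand side is the value of the empty phrase.
\<close>

lemma weight_relation:
  assumes "i < j" "j < r" "a \<in> \<alpha>"
  shows "weight i j a \<otimes> weight i j (\<tau> a) = \<one>"
proof -
  let ?p = "antiparallel_chords r i j (\<tau> a) a"
  have \<tau>a: "\<tau> a \<in> \<alpha>"
    using \<tau>_closed assms by auto
  then have p: "?p \<in> nanophrases \<alpha> r"
    using assms by (simp add: antiparallel_chords_nanophrase)
  have contribution: "val (restrict_letters {X} ?p) \<otimes> inv val (empty_phrase r) = weight i j (proj ?p X)"
    if "X \<in> {0, 1}" for X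
    using assms that
    by (intro letter_contribution[OF p]) (auto simp: letters_antiparallel_chords count_antiparallel_chords)
  have closed: "weight i j a \<in> carrier G" "weight i j (\<tau> a) \<in> carrier G" "val (empty_phrase r) \<in> carrier G"
    using assms \<tau>a by (simp_all add: weight_closed val_closed empty_phrase_nanophrase)
  have "val (empty_phrase r) = val ?p"
    unfolding val_def
    using homotopy_class_antiparallel_chords[OF assms(1,2) \<tau>a assms(3), of \<tau> S] by simp
  also have "\<dots> = val (empty_phrase r) \<otimes>
      (\<Otimes>X\<in>{0, 1}. val (restrict_letters {X} ?p) \<otimes> inv val (empty_phrase r))"
    using val_eq_product_over_letters[OF p] unfolding letters_antiparallel_chords[OF assms(1,2)] .
  also have "(\<Otimes>X\<in>{0, 1}. val (restrict_letters {X} ?p) \<otimes> inv val (empty_phrase r)) =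
      weight i j (\<tau> a) \<otimes> weight i j a"
    using contribution[of 0] contribution[of 1] closed
    by (simp add: proj_antiparallel_chords)
  finally show ?thesis
    using closed by (metis m_comm m_closed r_cancel_one')
qed

lemma weight_hom:
  assumes "i < j" "j < r"
  obtains h where "h \<in> hom (pi_group \<alpha> \<tau>) G" "\<And>a. a \<in> \<alpha> \<Longrightarrow> h (pi_gen \<alpha> \<tau> a) = weight i j a"
  using assms weight_closed weight_relation
  by (auto intro: pi_group_universal[OF \<tau>_closed, of "weight i j"])

text \<open>
  The product over the letters, grouped by the components that contain them. The diagonal pairs
  \<open>i = j\<close> are kept so that the index set partitions all letters; their factors are trivial.
\<close>

lemma val_eq_product_over_components:
  assumes p: "p \<in> nanophrases \<alpha> r"
  shows "val p = val (empty_phrase r) \<otimes>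
    finprod G (\<lambda>(i, j). \<Otimes>X\<in>letters_between p i j. weight i j (proj p X)) {(i, j). i \<le> j \<and> j < r}"
proof -
  let ?I = "{(i, j). i \<le> j \<and> j < r}"
  let ?c = "\<lambda>X. val (restrict_letters {X} p) \<otimes> inv val (empty_phrase r)"
  have proj: "proj p X \<in> \<alpha>" if "X \<in> letters p" for X
    using p that by (auto simp: nanophrases_def)
  have between: "X \<in> letters p" "?c X = weight i j (proj p X)"
    if "i \<le> j" "j < r" "X \<in> letters_between p i j" for i j X
  proof -
    show X: "X \<in> letters p"
      using letters_between_subset[OF p, of i j] that by auto
    obtain i' j' where ij': "i' \<le> j'" "j' < r"
      "\<forall>k<r. count_list (words p ! k) X = of_bool (k = i') + of_bool (k = j')"
      by (rule letters_cases[OF p X])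
    with that letters_between_iff[OF ij'(1,2) that(1,2) ij'(3)]
    show "?c X = weight i j (proj p X)"
      using letter_contribution[OF p X _ _ ij'(3)] by simp
  qed
  have "finite ?I"
    by (rule finite_subset[of _ "{..<r} \<times> {..<r}"]) auto
  have disjoint: "(i, j) = (i', j')"
    if ij: "i \<le> j" "j < r" "i' \<le> j'" "j' < r"
      and X: "X \<in> letters_between p i j" "X \<in> letters_between p i' j'" for i j i' j' X
  proof -
    have "X \<in> letters p"
      using between(1) ij X by blast
    with p obtain i0 j0 where "i0 \<le> j0" "j0 < r"
      "\<forall>k<r. count_list (words p ! k) X = of_bool (k = i0) + of_bool (k = j0)"
      by (rule letters_cases)
    from letters_between_iff[OF this(1,2) ij(1,2) this(3)] letters_between_iff[OF this(1,2) ij(3,4) this(3)] X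
    show ?thesis
      by simp
  qed
  have "(\<Otimes>X\<in>letters p. ?c X) = (\<Otimes>e\<in>?I. \<Otimes>X\<in>(case e of (i, j) \<Rightarrow> letters_between p i j). ?c X)"
    unfolding letters_eq_UN_letters_between[OF p]
  proof (rule finprod_UN_disjoint[OF \<open>finite ?I\<close>])
    show "finite (case e of (i, j) \<Rightarrow> letters_between p i j)" if "e \<in> ?I" for e
      using that between(1) by (auto intro: finite_subset[OF _ finite_letters])
    show "pairwise (\<lambda>e e'. disjnt (case e of (i, j) \<Rightarrow> letters_between p i j)
        (case e' of (i, j) \<Rightarrow> letters_between p i j)) ?I"
      using disjoint by (fastforce simp: pairwise_def disjnt_iff)
    show "?c X \<in> carrier G" for X
      by (simp add: val_closed restrict_letters_nanophrase[OF p] empty_phrase_nanophrase)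
  qed
  also have "\<dots> = finprod G (\<lambda>(i, j). \<Otimes>X\<in>letters_between p i j. weight i j (proj p X)) ?I"
    using between proj weight_closed
    by (intro finprod_cong') (auto simp: Pi_iff intro!: finprod_cong' finprod_closed)
  finally show ?thesis
    using val_eq_product_over_letters[OF p] by simp
qed

text \<open>
  For \<open>i < j\<close> the product is the image of the linking number under the homomorphism that extends
  \<open>weight i j\<close>; for \<open>i = j\<close> all factors are trivial.
\<close>

lemma linking_number_determines_weights:
  assumes p: "p \<in> nanophrases \<alpha> r" and q: "q \<in> nanophrases \<alpha> r" and ij: "i \<le> j" "j < r"
    and link: "linking_number \<alpha> \<tau> p i j = linking_number \<alpha> \<tau> q i j"
  shows "(\<Otimes>X\<in>letters_between p i j. weight i j (proj p X)) =
    (\<Otimes>X\<in>letters_between q i j. weight i j (proj q X))"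
proof -
  have proj: "proj s X \<in> \<alpha>" if "s \<in> nanophrases \<alpha> r" "X \<in> letters_between s i j" for s X
    using letters_between_subset[OF that(1), of i j] that ij by (auto simp: nanophrases_def)
  show ?thesis
  proof (cases "i = j")
    case True
    have "(\<Otimes>X\<in>letters_between s i j. weight i j (proj s X)) = \<one>" if "s \<in> nanophrases \<alpha> r" for s
      using proj[OF that] ij True by (intro finprod_one_eqI) (simp add: weight_self)
    with p q show ?thesis
      by simp
  next
    case False
    with ij obtain h where h: "h \<in> hom (pi_group \<alpha> \<tau>) G"
      "\<And>a. a \<in> \<alpha> \<Longrightarrow> h (pi_gen \<alpha> \<tau> a) = weight i j a"
      using weight_hom[of i j] by auto
    have "(\<Otimes>X\<in>letters_between s i j. weight i j (proj s X)) = h (linking_number \<alpha> \<tau> s i j)"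
      if s: "s \<in> nanophrases \<alpha> r" for s
    proof -
      have "h (linking_number \<alpha> \<tau> s i j) = (\<Otimes>X\<in>letters_between s i j. h (pi_gen \<alpha> \<tau> (proj s X)))"
        using False proj[OF s]
        by (simp add: linking_number_def hom_finprod[OF comm_group_pi_group[OF \<tau>_closed] h(1)] pi_gen_closed)
      also have "\<dots> = (\<Otimes>X\<in>letters_between s i j. weight i j (proj s X))"
        using proj[OF s] ij h(2) weight_closed by (intro finprod_cong') auto
      finally show ?thesis by simp
    qed
    with p q link show ?thesis
      by simp
  qed
qed

lemma linking_numbers_determine_val:
  assumes p: "p \<in> nanophrases \<alpha> r" and q: "q \<in> nanophrases \<alpha> r"
    and "\<And>i j. \<lbrakk>i \<le> j; j < r\<rbrakk> \<Longrightarrow> linking_number \<alpha> \<tau> p i j = linking_number \<alpha> \<tau> q i j"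
  shows "val p = val q"
proof -
  have proj: "proj s X \<in> \<alpha>" if "s \<in> nanophrases \<alpha> r" "X \<in> letters_between s i j" "i < r" for s X i j
    using letters_between_subset[OF that(1), of i j] that by (auto simp: nanophrases_def)
  have "finprod G (\<lambda>(i, j). \<Otimes>X\<in>letters_between p i j. weight i j (proj p X)) {(i, j). i \<le> j \<and> j < r} =
      finprod G (\<lambda>(i, j). \<Otimes>X\<in>letters_between q i j. weight i j (proj q X)) {(i, j). i \<le> j \<and> j < r}"
  proof (rule finprod_cong')
    show "(\<lambda>(i, j). \<Otimes>X\<in>letters_between q i j. weight i j (proj q X)) \<in>
        {(i, j). i \<le> j \<and> j < r} \<rightarrow> carrier G"
      using weight_closed proj[OF q] by (auto intro!: finprod_closed)
  qed (use linking_number_determines_weights[OF p q] assms(3) in auto)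
  then show ?thesis
    by (simp add: val_eq_product_over_components p q)
qed

end

theorem theorem6p3:
  fixes \<alpha> :: "'a set" and \<tau> :: "'a \<Rightarrow> 'a" and S :: "('a \<times> 'a \<times> 'a) set" and r :: nat
    and p q :: "'a nanophrase" and G :: "('g, 'm) monoid_scheme"
  assumes "finite \<alpha>"
    and "\<tau> \<in> \<alpha> \<rightarrow> \<alpha>" and "\<forall>a \<in> \<alpha>. \<tau> (\<tau> a) = a"
    and "S \<subseteq> \<alpha> \<times> \<alpha> \<times> \<alpha>"
    and "0 < r"
    and "p \<in> nanophrases \<alpha> r" and "q \<in> nanophrases \<alpha> r"
    and "comm_group G"
    and "\<exists>v. finite_type_invariant \<alpha> \<tau> S r G v \<and> invariant_degree \<alpha> \<tau> S r G v = 1 \<and>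
           v (homotopy_class \<alpha> \<tau> S r p) \<noteq> v (homotopy_class \<alpha> \<tau> S r q)"
  shows "linking_matrix \<alpha> \<tau> r p \<noteq> linking_matrix \<alpha> \<tau> r q"
proof
  assume matrix: "linking_matrix \<alpha> \<tau> r p = linking_matrix \<alpha> \<tau> r q"
  obtain v n where v: "v \<in> homotopy_classes \<alpha> \<tau> S r \<rightarrow> carrier G"
    and n: "vanishes_above \<alpha> \<tau> S r G v n"
    and degree: "invariant_degree \<alpha> \<tau> S r G v = 1"
    and neq: "v (homotopy_class \<alpha> \<tau> S r p) \<noteq> v (homotopy_class \<alpha> \<tau> S r q)"
    using assms(9) by (auto simp: finite_type_invariant_def)
  \<comment> \<open>The degree is a least natural number, so the integer bound \<open>n\<close> first has to be replaced by a natural one.\<close>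
  have "vanishes_above \<alpha> \<tau> S r G v (int (nat n))"
    using n by (simp add: vanishes_above_def)
  then have "vanishes_above \<alpha> \<tau> S r G v (int (invariant_degree \<alpha> \<tau> S r G v))"
    unfolding invariant_degree_def by (rule LeastI)
  then have vanishes: "vanishes_above \<alpha> \<tau> S r G v 1"
    by (simp add: degree)
  interpret comm_group G by fact
  interpret degree_one_invariant G \<alpha> \<tau> S r v
  proof
    fix s A B
    assume s: "s \<in> nanophrases \<alpha> r" "A \<in> letters s" "B \<in> letters s" "A \<noteq> B"
    then have "distinct [A, B] \<and> set [A, B] \<subseteq> letters s \<and> 1 < int (length [A, B])"
      by simp
    with vanishes s(1) show "linear_extension G v (semi \<alpha> \<tau> S r [A, B] s) = \<one>\<^bsub>G\<^esub>"
      unfolding vanishes_above_def by blast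
  qed (use assms v in auto)
  have "linking_number \<alpha> \<tau> p i j = linking_number \<alpha> \<tau> q i j" if "i \<le> j" "j < r" for i j
    using arg_cong[OF matrix, of "\<lambda>M. M $$ (i, j)"] that by (simp add: linking_matrix_def)
  with assms(6,7) have "val p = val q"
    by (rule linking_numbers_determine_val)
  with neq show False
    by (simp add: val_def)
qed

end
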